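(* Let $A,B,X\in M_n(\mathbb C)$ with $A$ and $B$ positive definite, let $\lambda_1,\dots,\lambda_n$ be the eigenvalues of $A$ and $\nu_1,\dots,\nu_n$ the eigenvalues of $B$, and let $$\underline{\mathrm K}=\min\bigl\{\mathrm{K}\bigl((\lambda_i/\nu_j)^{1/2},2\bigr): i,j=1,2,\dots,n\bigr\}.$$ Let $v\in(0,1)$ and put $r=\min\{v,1-v\}$, $r_1=\min\{2r,1-2r\}$ and $\hat r_1=\min\{2r_1,1-2r_1\}$. (I) If $0<v\le\frac12$, then $$\|(1-v)AX+vXB\|_F^2-(1-v)^2\|AX-XB\|_F^2\ \le\ \underline{\mathrm K}^{-\hat r_1}\|A^{1-v}XB^v\|_F^2-r_1\|A^{1/2}XB^{1/2}-XB\|_F^2.$$ (II) If $\frac12<v<1$, then $$\|(1-v)AX+vXB\|_F^2-v^2\|AX-XB\|_F^2\ \le\ \underline{\mathrm K}^{-\hat r_1}\|A^{1-v}XB^v\|_F^2-r_1\|A^{1/2}XB^{1/2}-AX\|_F^2.$$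
   Context: $M_n(\mathbb C)$ is the algebra of $n\times n$ complex matrices and $\|\cdot\|_F$ is the Hilbert-Schmidt (Frobenius) norm. For $t>0$, $\mathrm{K}(t,2)=\frac{(t+1)^2}{4t}$ denotes the Kantorovich constant. *)

theory Defs
  imports
    Complex_Main
    "Jordan_Normal_Form.Char_Poly"
    "Jordan_Normal_Form.Schur_Decomposition"
begin

definition frobenius_norm :: "complex mat \<Rightarrow> real" where
  "frobenius_norm A = sqrt (\<Sum>i<dim_row A. \<Sum>j<dim_col A. (cmod (A $$ (i, j)))\<^sup>2)"

definition positive_definite :: "nat \<Rightarrow> complex mat \<Rightarrow> bool" where
  "positive_definite n A \<longleftrightarrow>
     A \<in> carrier_mat n n \<and> mat_adjoint A = A \<and>
     (\<forall>x \<in> carrier_vec n. x \<noteq> 0\<^sub>v n \<longrightarrow> 0 < Re ((A *\<^sub>v x) \<bullet>c x))"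

definition unitary_mat :: "nat \<Rightarrow> complex mat \<Rightarrow> bool" where
  "unitary_mat n U \<longleftrightarrow> U \<in> carrier_mat n n \<and> mat_adjoint U * U = 1\<^sub>m n"

(* The real power of a positive definite matrix, by the spectral functional calculus:
   U diag(d_i) U^* is sent to U diag(d_i powr p) U^*.  The result does not depend on the
   unitary diagonalization, so the description is unique.  If A has no diagonalization with
   positive eigenvalues the value is unspecified. *)
definition mat_powr :: "complex mat \<Rightarrow> real \<Rightarrow> complex mat" where
  "mat_powr A p = (let n = dim_row A in
     THE C. \<exists>U d. unitary_mat n U \<and> (\<forall>i<n. 0 < d i) \<and>
       A = U * mat_diag n (\<lambda>i. complex_of_real (d i)) * mat_adjoint U \<and>
       C = U * mat_diag n (\<lambda>i. complex_of_real (d i powr p)) * mat_adjoint U)"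

(* K(t, 2) *)
definition kantorovich :: "real \<Rightarrow> real" where
  "kantorovich t = (t + 1)\<^sup>2 / (4 * t)"

end

theory Submission
  imports Defs "HOL-Analysis.Convex" "HOL-Computational_Algebra.Fundamental_Theorem_Algebra"
begin

text \<open>
  Diagonalize \<open>A = U diag(d) U\<^sup>*\<close> and \<open>B = V diag(e) V\<^sup>*\<close>, and put \<open>Y = U\<^sup>* X V\<close>.
  Every matrix in the inequality has the form \<open>U (k\<^sub>i\<^sub>j Y\<^sub>i\<^sub>j) V\<^sup>*\<close>, so by unitary invariance its squared
  Frobenius norm is the sum of the \<open>k\<^sub>i\<^sub>j\<^sup>2 \<bar>Y\<^sub>i\<^sub>j\<bar>\<^sup>2\<close>, and it suffices to compare the coefficients of each
  \<open>\<bar>Y\<^sub>i\<^sub>j\<bar>\<^sup>2\<close>. With \<open>s\<^sup>2 = d\<^sub>i / e\<^sub>j\<close> that comparison is a reversed Young inequality. It follows from Young's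
  inequality improved by a power \<open>c\<close> of the Kantorovich constant, combined with the estimate
  \<open>2 \<surd>(x y) \<le> c x + y / c\<close>. The second half of the theorem is the first with the roles of
  \<open>d\<^sub>i\<close> and \<open>e\<^sub>j\<close> exchanged, as \<open>K(1/t) = K(t)\<close>.
\<close>

section \<open>Scalar inequalities\<close>

lemma kantorovich_pos: "0 < t \<Longrightarrow> 0 < kantorovich t"
  by (simp add: kantorovich_def)

lemma kantorovich_inverse: "0 < t \<Longrightarrow> kantorovich (1 / t) = kantorovich t"
  by (simp add: kantorovich_def power2_eq_square divide_simps) (simp add: algebra_simps)

lemma kantorovich_Young:
  fixes s w :: real
  assumes s: "0 < s" and w: "0 \<le> w" "w \<le> 1"
  shows "kantorovich s powr min w (1 - w) * s powr w \<le> w * s + (1 - w)"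
proof -
  \<comment> \<open>Both cases are the unrefined Young inequality between (s + 1) / 2 and the nearer endpoint 1 or s.\<close>
  have K: "kantorovich s = ((s + 1) / 2) powr 2 * s powr (- 1)"
    using s by (simp add: kantorovich_def powr_minus_divide power_divide power2_eq_square)
  \<comment> \<open>\<open>K(s)\<close> is the squared quotient of the arithmetic and geometric
    means of \<open>s\<close> and 1. Its power \<open>m\<close> trades a factor
    \<open>s powr m\<close> for \<open>((s + 1) / 2) powr (2 * m)\<close>, so that in both cases the
    remaining exponents add up to 1.\<close>
  have Kp: "kantorovich s powr m = ((s + 1) / 2) powr (2 * m) * s powr (- m)" for m
    using s unfolding K by (subst powr_mult) (auto simp only: powr_powr mult_minus1)
  show ?thesis
  proof (cases "w \<le> 1 / 2")
    case True
    then have "kantorovich s powr min w (1 - w) * s powr w = ((s + 1) / 2) powr (2 * w) * 1 powr (1 - 2 * w)"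
      using s by (simp add: Kp min_def mult.assoc powr_add[symmetric])
    also have "\<dots> \<le> 2 * w * ((s + 1) / 2) + (1 - 2 * w) * 1"
      using s w True by (intro Youngs_inequality_0) auto
    finally show ?thesis by (simp add: field_simps)
  next
    case False
    then have "kantorovich s powr min w (1 - w) * s powr w
        = ((s + 1) / 2) powr (2 * (1 - w)) * s powr (2 * w - 1)"
      using s by (simp add: Kp min_def mult.assoc powr_add[symmetric])
    also have "\<dots> \<le> 2 * (1 - w) * ((s + 1) / 2) + (2 * w - 1) * s"
      using s w False by (intro Youngs_inequality_0) auto
    finally show ?thesis by (simp add: field_simps)
  qed
qed

text \<open>The arithmetic-geometric mean inequality for \<open>c * x\<close> and
  \<open>y / c\<close>, whose product is free of \<open>c\<close>. It reverses Young's inequality: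
  an upper bound on \<open>c * x\<close> becomes a lower bound on \<open>y / c\<close>.\<close>

lemma sum_reciprocal_weights_ge:
  fixes x y c :: real
  assumes "0 < c" "0 \<le> x" "0 \<le> y"
  shows "2 * sqrt (x * y) \<le> c * x + y / c"
proof -
  have "0 \<le> (sqrt (c * x) - sqrt (y / c))\<^sup>2" by simp
  also have "\<dots> = c * x + y / c - 2 * sqrt (x * y)"
    using assms by (simp add: power2_diff real_sqrt_mult[symmetric])
  finally show ?thesis by simp
qed

text \<open>This is the coefficient inequality of the first half, normalized to
  \<open>a = s\<^sup>2\<close> and \<open>b = 1\<close>. There the difference of squares \<open>((1
  - v) * a + v * b)\<^sup>2 - (1 - v)\<^sup>2 * (a - b)\<^sup>2\<close> has a factor equal to 1 and
  leaves an expression linear in \<open>s\<^sup>2\<close>. The split at \<open>v = 1 / 4\<close> is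
  where \<open>r1\<close> changes branch.\<close>

lemma refined_reverse_Young:
  fixes s v :: real
  assumes s: "0 < s" and v: "0 \<le> v" "v \<le> 1 / 2"
  defines "r1 \<equiv> min (2 * v) (1 - 2 * v)"
  defines "R \<equiv> min (2 * r1) (1 - 2 * r1)"
  shows "2 * (1 - v) * s\<^sup>2 - (1 - 2 * v) + r1 * (s - 1)\<^sup>2
    \<le> kantorovich s powr (- R) * s powr (4 * (1 - v))"
proof -
  define k where "k = kantorovich s powr R"
  have k: "0 < k" using kantorovich_pos[OF s] by (simp add: k_def)
  have kR: "kantorovich s powr (- R) * z = z / k" for z
    by (simp add: k_def powr_minus_divide)
  show ?thesis
  proof (cases "v \<le> 1 / 4")
    case True
    then have r1: "r1 = 2 * v" and R: "R = min (4 * v) (1 - 4 * v)" by (auto simp: r1_def R_def)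
    \<comment> \<open>With \<open>r1 = 2 * v\<close> the left-hand side of the goal collapses to
      \<open>2 * s\<^sup>2 - (4 * v * s + (1 - 4 * v))\<close>. The bracket is a Young mean of
      weight \<open>4 * v\<close>, and \<open>s\<^sup>2\<close> is the geometric mean of
      \<open>s powr (4 * v)\<close> and \<open>s powr (4 * (1 - v))\<close>.\<close>
    have "2 * sqrt (s powr (4 * v) * s powr (4 * (1 - v))) \<le> k * s powr (4 * v) + s powr (4 * (1 - v)) / k"
      using k by (intro sum_reciprocal_weights_ge) auto
    also have "s powr (4 * v) * s powr (4 * (1 - v)) = (s\<^sup>2)\<^sup>2"
      using s unfolding powr_add[symmetric] by (simp add: algebra_simps power_mult[symmetric])
    also have "sqrt ((s\<^sup>2)\<^sup>2) = s\<^sup>2" unfolding real_sqrt_abs by simp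
    also have "k * s powr (4 * v) \<le> 4 * v * s + (1 - 4 * v)"
      unfolding k_def R using s v True by (intro kantorovich_Young) auto
    finally show ?thesis
      unfolding kR r1 by (simp add: power2_eq_square algebra_simps)
  next
    case False
    then have r1: "r1 = 1 - 2 * v" and R: "R = min (4 * v - 1) (1 - (4 * v - 1))"
      using v by (auto simp: r1_def R_def)
    \<comment> \<open>With \<open>r1 = 1 - 2 * v\<close> the left-hand side of the goal is
      \<open>s * (2 * s - ((4 * v - 1) * s + (2 - 4 * v)))\<close>. The inner bracket is a Young
      mean of weight \<open>4 * v - 1\<close>; the outer factor \<open>s\<close> is restored at the
      end and raises the exponent \<open>3 - 4 * v\<close> to \<open>4 * (1 - v)\<close>.\<close>
    have "2 * sqrt (s powr (4 * v - 1) * s powr (3 - 4 * v)) \<le> k * s powr (4 * v - 1) + s powr (3 - 4 * v) / k"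
      using k by (intro sum_reciprocal_weights_ge) auto
    also have "s powr (4 * v - 1) * s powr (3 - 4 * v) = s\<^sup>2"
      using s by (simp add: powr_add[symmetric])
    also have "sqrt (s\<^sup>2) = s" using s by simp
    also have "k * s powr (4 * v - 1) \<le> (4 * v - 1) * s + (1 - (4 * v - 1))"
      unfolding k_def R using s v False by (intro kantorovich_Young) auto
    finally have "(3 - 4 * v) * s - (2 - 4 * v) \<le> s powr (3 - 4 * v) / k"
      by (simp add: algebra_simps)
    then have "s * ((3 - 4 * v) * s - (2 - 4 * v)) \<le> s * (s powr (3 - 4 * v) / k)"
      using s by (intro mult_left_mono) auto
    also have "s * (s powr (3 - 4 * v) / k) = s powr (4 * (1 - v)) / k"
      using s powr_add[of s 1 "3 - 4 * v"] by (simp add: algebra_simps)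
    finally show ?thesis
      unfolding kR r1 by (simp add: power2_eq_square algebra_simps)
  qed
qed

text \<open>Both sides are homogeneous of degree 2 in \<open>(a, b)\<close>, so dividing by
  \<open>b\<^sup>2\<close> leaves the one-variable bound at \<open>s\<^sup>2 = a / b\<close>. The
  free lower bound \<open>k\<close> allows one constant to serve all pairs of eigenvalues.\<close>

lemma two_variable_bound:
  fixes a b v k :: real
  assumes ab: "0 < a" "0 < b" and v: "0 \<le> v" "v \<le> 1 / 2"
    and k: "0 < k" "k \<le> kantorovich ((a / b) powr (1/2))"
  defines "r1 \<equiv> min (2 * v) (1 - 2 * v)"
  defines "R \<equiv> min (2 * r1) (1 - 2 * r1)"
  shows "((1 - v) * a + v * b)\<^sup>2 - (1 - v)\<^sup>2 * (a - b)\<^sup>2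
    \<le> k powr (- R) * (a powr (1 - v) * b powr v)\<^sup>2 - r1 * (a powr (1/2) * b powr (1/2) - b)\<^sup>2"
proof -
  define s where "s = (a / b) powr (1/2)"
  have s: "0 < s" using ab by (simp add: s_def)
  have s2: "s\<^sup>2 = a / b" using ab powr_powr[of "a / b" "1 / 2" 2] by (simp add: s_def)
  then have a: "a = s\<^sup>2 * b" using ab by simp
  have R: "0 \<le> R" using v by (auto simp: R_def r1_def min_def)
  have ap: "a powr p = s powr (2 * p) * b powr p" for p
    using s ab powr_powr[of s 2 p] by (simp add: a powr_mult)
  have "(a powr (1 - v) * b powr v)\<^sup>2 = a powr (2 * (1 - v)) * b powr (2 * v)"
    by (simp add: power2_eq_square powr_add[symmetric] mult.assoc mult.left_commute[of _ "b powr v"])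
      (simp add: powr_add[symmetric] mult.assoc[symmetric])
  also have "\<dots> = s powr (4 * (1 - v)) * (b powr (2 * (1 - v)) * b powr (2 * v))"
    unfolding ap[of "2 * (1 - v)"] by (simp add: mult.assoc)
  also have "b powr (2 * (1 - v)) * b powr (2 * v) = b\<^sup>2"
    using ab unfolding powr_add[symmetric] by (simp add: algebra_simps)
  finally have "(a powr (1 - v) * b powr v)\<^sup>2 = s powr (4 * (1 - v)) * b\<^sup>2" .
  moreover have "a powr (1/2) * b powr (1/2) = s * b"
    using s ab by (simp add: ap mult.assoc powr_add[symmetric])
  moreover have "((1 - v) * a + v * b)\<^sup>2 - (1 - v)\<^sup>2 * (a - b)\<^sup>2 = (2 * (1 - v) * s\<^sup>2 - (1 - 2 * v)) * b\<^sup>2"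
    unfolding a by (simp add: power2_eq_square algebra_simps)
  moreover have "(2 * (1 - v) * s\<^sup>2 - (1 - 2 * v) + r1 * (s - 1)\<^sup>2) * b\<^sup>2
      \<le> k powr (- R) * s powr (4 * (1 - v)) * b\<^sup>2"
  proof (rule mult_right_mono)
    \<comment> \<open>Since \<open>R\<close> is nonnegative, the power with exponent
      \<open>- R\<close> is decreasing, so the smaller base \<open>k\<close> gives the weaker
      bound.\<close>
    have "kantorovich s powr (- R) \<le> k powr (- R)"
      using k R unfolding s_def by (intro powr_mono2') auto
    then have "kantorovich s powr (- R) * s powr (4 * (1 - v)) \<le> k powr (- R) * s powr (4 * (1 - v))"
      by (rule mult_right_mono) simp
    with refined_reverse_Young[OF s v]
    show "2 * (1 - v) * s\<^sup>2 - (1 - 2 * v) + r1 * (s - 1)\<^sup>2 \<le> k powr (- R) * s powr (4 * (1 - v))"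
      by (simp add: r1_def R_def)
  qed simp
  moreover have "(s * b - b)\<^sup>2 = (s - 1)\<^sup>2 * b\<^sup>2"
    by (simp add: power2_eq_square algebra_simps)
  ultimately show ?thesis by (simp add: algebra_simps)
qed

text \<open>Exchanging \<open>a\<close> with \<open>b\<close> and \<open>v\<close> with
  \<open>1 - v\<close> gives this from the previous bound. The condition on \<open>k\<close> keeps
  the quotient \<open>a / b\<close>, so the same minimum applies to both halves.\<close>

lemma two_variable_bound_swap:
  fixes a b v k :: real
  assumes ab: "0 < a" "0 < b" and v: "1 / 2 \<le> v" "v \<le> 1"
    and k: "0 < k" "k \<le> kantorovich ((a / b) powr (1/2))"
  defines "r1 \<equiv> min (2 * (1 - v)) (1 - 2 * (1 - v))"
  defines "R \<equiv> min (2 * r1) (1 - 2 * r1)"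
  shows "((1 - v) * a + v * b)\<^sup>2 - v\<^sup>2 * (a - b)\<^sup>2
    \<le> k powr (- R) * (a powr (1 - v) * b powr v)\<^sup>2 - r1 * (a powr (1/2) * b powr (1/2) - a)\<^sup>2"
proof -
  have "(b / a) powr (1/2) = 1 / (a / b) powr (1/2)"
    using ab by (simp add: powr_divide)
  then have "k \<le> kantorovich ((b / a) powr (1/2))"
    using k kantorovich_inverse[of "(a / b) powr (1/2)"] ab by simp
  from two_variable_bound[OF ab(2,1) _ _ k(1) this, of "1 - v"] v show ?thesis
    by (simp add: r1_def R_def power2_commute[of b a] mult.commute add.commute)
qed

section \<open>Adjoints and unitary diagonalization\<close>

lemma mat_adjoint_carrier [simp, intro]:
  "A \<in> carrier_mat n m \<Longrightarrow> mat_adjoint A \<in> carrier_mat m n"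
  by (auto simp: mat_adjoint_def)

lemma mat_adjoint_dim [simp]:
  "dim_row (mat_adjoint A) = dim_col A" "dim_col (mat_adjoint A) = dim_row A"
  by (auto simp: mat_adjoint_def)

lemma mat_adjoint_index [simp]:
  "i < dim_col A \<Longrightarrow> j < dim_row A \<Longrightarrow> mat_adjoint A $$ (i, j) = conjugate (A $$ (j, i))"
  by (simp add: mat_adjoint_def mat_of_rows_def)

lemma mat_adjoint_adjoint [simp]:
  "mat_adjoint (mat_adjoint A) = (A :: 'a :: conjugatable_field mat)"
  by (rule eq_matI) auto

lemma mat_adjoint_mult:
  fixes A B :: "'a :: conjugatable_field mat"
  assumes "A \<in> carrier_mat n m" "B \<in> carrier_mat m k"
  shows "mat_adjoint (A * B) = mat_adjoint B * mat_adjoint A"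
proof (rule eq_matI)
  fix i j assume "i < dim_row (mat_adjoint B * mat_adjoint A)" "j < dim_col (mat_adjoint B * mat_adjoint A)"
  with assms show "mat_adjoint (A * B) $$ (i, j) = (mat_adjoint B * mat_adjoint A) $$ (i, j)"
    by (auto simp: scalar_prod_def sum_conjugate conjugate_dist_mul mult.commute intro!: sum.cong)
qed (use assms in auto)

lemma conjugation_mult:
  fixes U V D :: "'a :: conjugatable_field mat"
  assumes "U \<in> carrier_mat n n" "V \<in> carrier_mat n n" "D \<in> carrier_mat n n"
  shows "U * (V * D * mat_adjoint V) * mat_adjoint U = (U * V) * D * mat_adjoint (U * V)"
  using assms
  by (simp add: mat_adjoint_mult[of _ n n _ n] assoc_mult_mat[of _ n n _ n _ n] mult_carrier_mat[of _ n n _ n])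

lemma hermitian_conjugation:
  fixes U A :: "'a :: conjugatable_field mat"
  assumes "U \<in> carrier_mat n n" "A \<in> carrier_mat n n" "mat_adjoint A = A"
  shows "mat_adjoint (mat_adjoint U * A * U) = mat_adjoint U * A * U"
  using assms
  by (simp add: mat_adjoint_mult[of _ n n _ n] assoc_mult_mat[of _ n n _ n _ n] mult_carrier_mat[of _ n n _ n])

lemma unitary_matD:
  assumes "unitary_mat n U"
  shows "U \<in> carrier_mat n n" "mat_adjoint U \<in> carrier_mat n n"
    "mat_adjoint U * U = 1\<^sub>m n" "U * mat_adjoint U = 1\<^sub>m n"
  using assms mat_mult_left_right_inverse[of "mat_adjoint U" n U]
  by (auto simp: unitary_mat_def)

lemma unitary_mat_mult:
  assumes U: "unitary_mat n U" and V: "unitary_mat n V"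
  shows "unitary_mat n (U * V)"
proof -
  note u = unitary_matD[OF U] and v = unitary_matD[OF V]
  have "mat_adjoint V * mat_adjoint U * (U * V) = mat_adjoint V * (mat_adjoint U * U) * V"
    using u(1,2) v(1,2) by (simp add: assoc_mult_mat[of _ n n _ n _ n] mult_carrier_mat[of _ n n _ n])
  then show ?thesis
    using u v by (simp add: unitary_mat_def mat_adjoint_mult[of _ n n _ n])
qed

lemma unitary_conjugation_iff:
  assumes U: "unitary_mat n U" and A: "A \<in> carrier_mat n n" and D: "D \<in> carrier_mat n n"
  shows "A = U * D * mat_adjoint U \<longleftrightarrow> mat_adjoint U * A * U = D"
proof -
  note u = unitary_matD[OF U]
  have "mat_adjoint U * (U * D * mat_adjoint U) * U = (mat_adjoint U * U) * D * (mat_adjoint U * U)"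
    using u(1,2) D by (simp add: assoc_mult_mat[of _ n n _ n _ n] mult_carrier_mat[of _ n n _ n])
  moreover have "U * (mat_adjoint U * A * U) * mat_adjoint U = (U * mat_adjoint U) * A * (U * mat_adjoint U)"
    using u(1,2) A by (simp add: assoc_mult_mat[of _ n n _ n _ n] mult_carrier_mat[of _ n n _ n])
  ultimately show ?thesis
    unfolding u(3,4) left_mult_one_mat[OF A] left_mult_one_mat[OF D]
      right_mult_one_mat[OF A] right_mult_one_mat[OF D] by metis
qed

section \<open>Spectral theorem for Hermitian and positive definite matrices\<close>

text \<open>Complete \<open>v\<close> to a basis and orthogonalize by Gram-Schmidt, which keeps the
  first vector. Dividing each column by its length makes the matrix unitary, and \<open>c\<close> is
  the reciprocal length of \<open>v\<close>.\<close>

lemma exists_unitary_col: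
  fixes v :: "complex vec"
  assumes v: "v \<in> carrier_vec n" and v0: "v \<noteq> 0\<^sub>v n"
  obtains U c where "unitary_mat n U" "c \<noteq> 0" "col U 0 = c \<cdot>\<^sub>v v"
proof -
  interpret cof_vec_space n "TYPE(complex)" .
  define b where "b = basis_completion v"
  define ws where "ws = gram_schmidt n b"
  define W where "W = mat_of_cols n ws"
  from basis_completion[OF v v0, folded b_def]
  have dist_b: "distinct b" and indep: "\<not> lin_dep (set b)" and b: "set b \<subseteq> carrier_vec n"
    and hdb: "hd b = v" and len_b: "length b = n" by auto
  have n: "n \<noteq> 0" using v v0 by (metis carrier_vec_dim_vec eq_vecI index_zero_vec(2) less_nat_zero_code carrier_vecD)
  from hdb len_b n obtain vs where bv: "b = v # vs" by (cases b) auto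
  from gram_schmidt_result[OF b dist_b indep refl, folded ws_def]
  have ws: "set ws \<subseteq> carrier_vec n" "corthogonal ws" "length ws = n"
    by (auto simp: len_b)
  from gram_schmidt_hd[OF v, of vs, folded bv] have hdws: "hd ws = v" unfolding ws_def .
  have orth_W: "corthogonal_mat W" using orthogonal_mat_of_cols ws unfolding W_def .
  have W: "W \<in> carrier_mat n n"
    using ws unfolding W_def using mat_of_cols_carrier(1)[of n ws] by auto
  have colW0: "col W 0 = v"
    using hdws ws n unfolding W_def by (cases ws) auto
  \<comment> \<open>The columns of \<open>W\<close> are orthogonal and nonzero but not yet
    normalized; \<open>s i\<close> is the Euclidean length of column \<open>i\<close>.\<close>
  define s where "s i = sqrt (\<Sum>k<n. (cmod (W $$ (k, i)))\<^sup>2)" for i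
  have ss: "col W j \<bullet>c col W i = (\<Sum>k<n. W $$ (k, j) * cnj (W $$ (k, i)))"
    if "i < n" "j < n" for i j
    using that W by (auto simp: scalar_prod_def lessThan_atLeast0 intro!: sum.cong)
  have diag: "col W i \<bullet>c col W i = complex_of_real ((s i)\<^sup>2)" if "i < n" for i
    unfolding ss[OF that that] s_def
    by (simp add: sum_nonneg complex_norm_square[symmetric] del: of_real_power)
  have s0: "s i \<noteq> 0" if "i < n" for i
    using corthogonal_matD[OF orth_W, of i i] diag[OF that] that W by auto
  define U where "U = mat n n (\<lambda>(k, j). W $$ (k, j) / complex_of_real (s j))"
  have U: "U \<in> carrier_mat n n" by (simp add: U_def)
  have "mat_adjoint U * U = 1\<^sub>m n"
  proof (rule eq_matI)
    fix i j assume ij: "i < dim_row (1\<^sub>m n :: complex mat)" "j < dim_col (1\<^sub>m n :: complex mat)"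
    then have ij': "i < n" "j < n" by auto
    have "(mat_adjoint U * U) $$ (i, j)
        = (\<Sum>k<n. cnj (W $$ (k, i)) / s i * (W $$ (k, j) / s j))"
      using ij' U by (auto simp: scalar_prod_def lessThan_atLeast0 U_def intro!: sum.cong)
    also have "\<dots> = (col W j \<bullet>c col W i) / (s i * s j)"
      unfolding ss[OF ij'] sum_divide_distrib by (intro sum.cong) (auto simp: field_simps)
    also have "\<dots> = (1\<^sub>m n) $$ (i, j)"
    proof (cases "i = j")
      case True
      then show ?thesis using diag[of i] s0[of i] ij' by (simp add: power2_eq_square)
    next
      case False
      then have "col W j \<bullet>c col W i = 0"
        using corthogonal_matD[OF orth_W, of j i] W ij' by auto
      then show ?thesis using False ij' by simp
    qed
    finally show "(mat_adjoint U * U) $$ (i, j) = (1\<^sub>m n) $$ (i, j)" .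
  qed (use U in auto)
  with U have "unitary_mat n U" by (simp add: unitary_mat_def)
  moreover have "col U 0 = (1 / complex_of_real (s 0)) \<cdot>\<^sub>v v"
    using n W unfolding colW0[symmetric] U_def by (intro eq_vecI) auto
  moreover have "1 / complex_of_real (s 0) \<noteq> 0" using s0[of 0] n by simp
  ultimately show thesis using that by blast
qed

lemma complex_eigenvalue_exists:
  fixes A :: "complex mat"
  assumes "A \<in> carrier_mat n n" "0 < n"
  obtains e where "eigenvalue A e"
proof -
  have "degree (char_poly A) \<noteq> 0" using degree_monic_char_poly[OF assms(1)] assms(2) by simp
  then obtain e where "poly (char_poly A) e = 0"
    using fundamental_theorem_of_algebra[of "char_poly A"] by (auto simp: constant_degree)
  then show thesis using that eigenvalue_root_char_poly[OF assms(1)] by blast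
qed

lemma mat_adjoint_four_block:
  fixes A B C D :: "'a :: conjugatable_field mat"
  assumes "A \<in> carrier_mat a b" "B \<in> carrier_mat a d" "C \<in> carrier_mat c b" "D \<in> carrier_mat c d"
  shows "mat_adjoint (four_block_mat A B C D)
    = four_block_mat (mat_adjoint A) (mat_adjoint C) (mat_adjoint B) (mat_adjoint D)"
  using assms by (intro eq_matI) (auto simp: four_block_mat_def Let_def)

lemma mult_block_diag:
  fixes A B C D :: "'a :: comm_ring_1 mat"
  assumes "A \<in> carrier_mat m m" "B \<in> carrier_mat n n" "C \<in> carrier_mat m m" "D \<in> carrier_mat n n"
  shows "four_block_mat A (0\<^sub>m m n) (0\<^sub>m n m) B * four_block_mat C (0\<^sub>m m n) (0\<^sub>m n m) D
    = four_block_mat (A * C) (0\<^sub>m m n) (0\<^sub>m n m) (B * D)"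
  by (subst mult_four_block_mat[of _ m m _ n _ n _ _ m _ n]) (use assms in auto)

text \<open>Deflation: in an orthonormal basis starting with an eigenvector, the first column
  vanishes below the diagonal, Hermitian symmetry clears the first row as well, and the remaining
  block is Hermitian of size one less. The diagonal is complex at this stage.\<close>

lemma hermitian_unitary_diagonalization:
  fixes A :: "complex mat"
  assumes "A \<in> carrier_mat n n" "mat_adjoint A = A"
  shows "\<exists>U d. unitary_mat n U \<and> A = U * mat_diag n d * mat_adjoint U"
  using assms
proof (induction n arbitrary: A)
  case 0
  show ?case
    using 0 by (intro exI[of _ "1\<^sub>m 0"] exI[of _ "\<lambda>_. 0"] conjI)
      (auto simp: unitary_mat_def simp del: mat_diag_one)
next
  case (Suc n A)
  note A = Suc.prems(1) and herm = Suc.prems(2)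
  obtain e where "eigenvalue A e" using complex_eigenvalue_exists[OF A] by auto
  then obtain v where v: "v \<in> carrier_vec (Suc n)" "v \<noteq> 0\<^sub>v (Suc n)" and ev: "A *\<^sub>v v = e \<cdot>\<^sub>v v"
    using A by (auto simp: eigenvalue_def eigenvector_def)
  obtain U c where U: "unitary_mat (Suc n) U" and c: "c \<noteq> 0" and col: "col U 0 = c \<cdot>\<^sub>v v"
    using exists_unitary_col[OF v] .
  note u = unitary_matD[OF U]
  define M where "M = mat_adjoint U * A * U"
  have M: "M \<in> carrier_mat (Suc n) (Suc n)" using u A by (auto simp: M_def)
  have hM: "mat_adjoint M = M"
    unfolding M_def by (rule hermitian_conjugation[OF u(1) A herm])
  have "col (A * U) 0 = e \<cdot>\<^sub>v col U 0"
  proof -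
    have "col (A * U) 0 = A *\<^sub>v (c \<cdot>\<^sub>v v)" unfolding col[symmetric] by (rule col_mult2[OF A u(1)]) simp
    also have "\<dots> = c \<cdot>\<^sub>v (e \<cdot>\<^sub>v v)" using mult_mat_vec[OF A v(1)] ev by simp
    finally show ?thesis unfolding col by (simp add: smult_smult_assoc mult.commute)
  qed
  then have "col M 0 = mat_adjoint U *\<^sub>v (e \<cdot>\<^sub>v col U 0)"
    unfolding M_def assoc_mult_mat[OF u(2) A u(1)]
    using col_mult2[OF u(2) mult_carrier_mat[OF A u(1)], of 0] by simp
  also have "\<dots> = e \<cdot>\<^sub>v (mat_adjoint U *\<^sub>v col U 0)"
    using mult_mat_vec[OF u(2), of "col U 0"] u(1) by auto
  also have "mat_adjoint U *\<^sub>v col U 0 = col (1\<^sub>m (Suc n)) 0"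
    unfolding u(3)[symmetric] using u(1,2) by (simp add: col_mult2[of _ "Suc n" "Suc n" _ "Suc n"])
  finally have colM: "col M 0 = e \<cdot>\<^sub>v unit_vec (Suc n) 0" by simp
  have M0: "M $$ (i, 0) = (if i = 0 then e else 0)" if "i < Suc n" for i
    using arg_cong[OF colM, of "\<lambda>w. w $ i"] that M by auto
  have M0': "M $$ (0, i) = (if i = 0 then e else 0)" if "i < Suc n" for i
  proof (cases "i = 0")
    case False
    have "M $$ (0, i) = cnj (M $$ (i, 0))"
      using that M hM mat_adjoint_index[of 0 M i] by simp
    then show ?thesis using False M0[OF that] by simp
  qed (use M0 in simp)
  define M3 where "M3 = mat n n (\<lambda>(i, j). M $$ (Suc i, Suc j))"
  have M3: "M3 \<in> carrier_mat n n" by (simp add: M3_def)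
  have "mat_adjoint M3 = M3"
  proof (rule eq_matI)
    fix i j assume "i < dim_row M3" "j < dim_col M3"
    then have "i < n" "j < n" using M3 by auto
    then show "mat_adjoint M3 $$ (i, j) = M3 $$ (i, j)"
      using M mat_adjoint_index[of "Suc i" M "Suc j"] by (simp add: M3_def hM)
  qed (use M3 in auto)
  with Suc.IH[OF M3] obtain V d where V: "unitary_mat n V" and M3V: "M3 = V * mat_diag n d * mat_adjoint V"
    by blast
  note w = unitary_matD[OF V]
  define P where "P = four_block_mat (1\<^sub>m 1) (0\<^sub>m 1 n) (0\<^sub>m n 1) V"
  \<comment> \<open>The split-off eigenvalue \<open>e\<close> occupies position 0, so the
    eigenvalues of the block move up by one.\<close>
  define d' where "d' i = (if i = 0 then e else d (i - 1))" for i
  have one: "mat_adjoint (1\<^sub>m 1) = (1\<^sub>m 1 :: complex mat)"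
    and zero: "mat_adjoint (0\<^sub>m k l) = (0\<^sub>m l k :: complex mat)" for k l
    by (auto intro!: eq_matI)
  have P': "mat_adjoint P = four_block_mat (1\<^sub>m 1) (0\<^sub>m 1 n) (0\<^sub>m n 1) (mat_adjoint V)"
    unfolding P_def by (subst mat_adjoint_four_block[of _ 1 1 _ n _ n]) (use w in \<open>auto simp: one zero\<close>)
  have "mat_adjoint P * P = four_block_mat (1\<^sub>m 1) (0\<^sub>m 1 n) (0\<^sub>m n 1) (1\<^sub>m n)"
    unfolding P' unfolding P_def
    using mult_block_diag[OF one_carrier_mat[of 1] w(2) one_carrier_mat[of 1] w(1)] w(3) by simp
  then have P: "unitary_mat (Suc n) P"
    using w(1) by (auto simp: unitary_mat_def P_def)
  have D: "mat_diag (Suc n) d' = four_block_mat (mat 1 1 (\<lambda>_. e)) (0\<^sub>m 1 n) (0\<^sub>m n 1) (mat_diag n d)"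
    by (rule eq_matI) (auto simp: mat_diag_def d'_def four_block_mat_def Let_def)
  have E: "mat 1 1 (\<lambda>_. e) \<in> carrier_mat 1 1" by simp
  have "P * mat_diag (Suc n) d' * mat_adjoint P
      = four_block_mat (mat 1 1 (\<lambda>_. e)) (0\<^sub>m 1 n) (0\<^sub>m n 1) M3"
    unfolding D P' unfolding P_def
    using mult_block_diag[OF one_carrier_mat[of 1] w(1) E mat_diag_dim]
      mult_block_diag[OF E mult_carrier_mat[OF w(1) mat_diag_dim] one_carrier_mat[of 1] w(2)]
      left_mult_one_mat[OF E] right_mult_one_mat[OF E] by (simp only: M3V)
  also have "\<dots> = M"
    using M M0 M0' by (intro eq_matI) (auto simp: four_block_mat_def Let_def M3_def)
  finally have MP: "mat_adjoint U * A * U = P * mat_diag (Suc n) d' * mat_adjoint P"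
    by (simp add: M_def)
  have "P * mat_diag (Suc n) d' * mat_adjoint P \<in> carrier_mat (Suc n) (Suc n)"
    using unitary_matD(1,2)[OF P] by (meson mat_diag_dim mult_carrier_mat)
  from iffD2[OF unitary_conjugation_iff[OF U A this] MP]
  have "A = U * (P * mat_diag (Suc n) d' * mat_adjoint P) * mat_adjoint U" .
  also have "\<dots> = (U * P) * mat_diag (Suc n) d' * mat_adjoint (U * P)"
    using conjugation_mult[OF u(1) unitary_matD(1)[OF P] mat_diag_dim] .
  finally show ?case
    by (intro exI[of _ "U * P"] exI[of _ d'] conjI unitary_mat_mult[OF U P])
qed

text \<open>Each diagonal entry is the quadratic form of \<open>A\<close> at a unit column of
  \<open>U\<close>, hence has positive real part. It is real because conjugation by \<open>U\<close>
  preserves Hermitian matrices.\<close>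

lemma positive_definite_spectral:
  assumes "positive_definite n A"
  obtains U d where "unitary_mat n U" "\<forall>i<n. 0 < d i"
    "A = U * mat_diag n (\<lambda>i. complex_of_real (d i)) * mat_adjoint U"
proof -
  from assms have A: "A \<in> carrier_mat n n" and herm: "mat_adjoint A = A"
    and pos: "\<And>x. x \<in> carrier_vec n \<Longrightarrow> x \<noteq> 0\<^sub>v n \<Longrightarrow> 0 < Re ((A *\<^sub>v x) \<bullet>c x)"
    by (auto simp: positive_definite_def)
  obtain U D where U: "unitary_mat n U" and AD: "A = U * mat_diag n D * mat_adjoint U"
    using hermitian_unitary_diagonalization[OF A herm] by blast
  note u = unitary_matD[OF U]
  have diag: "mat_adjoint U * A * U = mat_diag n D"
    using iffD1[OF unitary_conjugation_iff[OF U A mat_diag_dim] AD] .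
  have inner: "(mat_adjoint U * B) $$ (i, i) = col B i \<bullet>c col U i"
    if "B \<in> carrier_mat n n" "i < n" for B i
    using that u(1) by (auto simp: scalar_prod_def mult.commute intro!: sum.cong)
  have D: "D i = (A *\<^sub>v col U i) \<bullet>c col U i" if "i < n" for i
  proof -
    have "D i = (mat_adjoint U * A * U) $$ (i, i)"
      unfolding diag using that by (simp add: mat_diag_def)
    also have "\<dots> = col (A * U) i \<bullet>c col U i"
      unfolding assoc_mult_mat[OF u(2) A u(1)] by (rule inner[OF mult_carrier_mat[OF A u(1)] that])
    finally show ?thesis using col_mult2[OF A u(1) that] by simp
  qed
  have real: "complex_of_real (Re (D i)) = D i" if "i < n" for i
  proof -
    have "mat_adjoint (mat_diag n D) $$ (i, i) = mat_diag n D $$ (i, i)"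
      unfolding diag[symmetric] hermitian_conjugation[OF u(1) A herm] ..
    then have "cnj (D i) = D i"
      using that by (simp add: mat_diag_def)
    then show ?thesis by (simp add: Reals_cnj_iff)
  qed
  have "0 < Re (D i)" if "i < n" for i
  proof -
    have "col U i \<bullet>c col U i = 1"
      using inner[OF u(1) that] that by (simp add: u(3))
    then have "col U i \<noteq> 0\<^sub>v n"
      by (metis conjugate_zero_vec scalar_prod_right_zero zero_carrier_vec zero_neq_one)
    moreover have "col U i \<in> carrier_vec n" using u(1) by (metis carrier_matD(1) col_dim)
    ultimately show ?thesis using pos D[OF that] by simp
  qed
  moreover have "mat_diag n D = mat_diag n (\<lambda>i. complex_of_real (Re (D i)))"
    using real by (intro eq_matI) (auto simp: mat_diag_def)
  ultimately show thesis using that[OF U, of "\<lambda>i. Re (D i)"] AD by simp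
qed

section \<open>Functional calculus and eigenvalues\<close>

text \<open>The unitary \<open>W = V* U\<close> intertwines the two diagonal matrices, so
  \<open>W $$ (i, j)\<close> can be nonzero only where \<open>d j = e i\<close>. There
  \<open>f\<close> takes equal values too, so \<open>W\<close> also intertwines the images under
  \<open>f\<close>.\<close>

lemma spectral_calculus_unique:
  fixes d e :: "nat \<Rightarrow> real" and f :: "real \<Rightarrow> real"
  assumes U: "unitary_mat n U" and V: "unitary_mat n V"
    and eq: "U * mat_diag n (\<lambda>i. complex_of_real (d i)) * mat_adjoint U
      = V * mat_diag n (\<lambda>i. complex_of_real (e i)) * mat_adjoint V"
  shows "U * mat_diag n (\<lambda>i. complex_of_real (f (d i))) * mat_adjoint U
      = V * mat_diag n (\<lambda>i. complex_of_real (f (e i))) * mat_adjoint V"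
proof -
  note u = unitary_matD[OF U] and v = unitary_matD[OF V]
  note simps = assoc_mult_mat[of _ n n _ n _ n] mult_carrier_mat[of _ n n _ n]
  define W where "W = mat_adjoint V * U"
  have W: "W \<in> carrier_mat n n" using u v by (auto simp: W_def)
  have cancel: "U * D * mat_adjoint U = V * E * mat_adjoint V \<longleftrightarrow> W * D = E * W"
    if D: "D \<in> carrier_mat n n" and E: "E \<in> carrier_mat n n" for D E
  proof
    assume "U * D * mat_adjoint U = V * E * mat_adjoint V"
    then have "mat_adjoint V * (U * D * mat_adjoint U) * U = mat_adjoint V * (V * E * mat_adjoint V) * U"
      by simp
    moreover have "mat_adjoint V * (U * D * mat_adjoint U) * U = W * D * (mat_adjoint U * U)"
      using u(1,2) v(1,2) D unfolding W_def by (simp add: simps)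
    moreover have "mat_adjoint V * (V * E * mat_adjoint V) * U = (mat_adjoint V * V) * E * W"
      using u(1,2) v(1,2) E unfolding W_def by (simp add: simps)
    ultimately show "W * D = E * W"
      using W D E unfolding u(3) v(3) by simp
  next
    assume "W * D = E * W"
    then have "V * (W * D) * mat_adjoint U = V * (E * W) * mat_adjoint U" by simp
    moreover have "V * (W * D) * mat_adjoint U = (V * mat_adjoint V) * U * D * mat_adjoint U"
      using u(1,2) v(1,2) D unfolding W_def by (simp add: simps)
    moreover have "V * (E * W) * mat_adjoint U = V * E * mat_adjoint V * (U * mat_adjoint U)"
      using u(1,2) v(1,2) E unfolding W_def by (simp add: simps)
    moreover have "V * E * mat_adjoint V \<in> carrier_mat n n"
      using v(1,2) E by (simp add: simps)
    ultimately show "U * D * mat_adjoint U = V * E * mat_adjoint V"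
      using left_mult_one_mat[OF u(1)] right_mult_one_mat[of "V * E * mat_adjoint V" n n]
      unfolding u(4) v(4) by simp
  qed
  have intertwine: "W * mat_diag n g = mat_diag n h * W
      \<longleftrightarrow> (\<forall>i<n. \<forall>j<n. W $$ (i, j) * g j = h i * W $$ (i, j))" for g h
    unfolding mat_diag_mult_left[OF W] mat_diag_mult_right[OF W] by (auto simp: mat_eq_iff)
  from eq have "\<forall>i<n. \<forall>j<n. W $$ (i, j) * complex_of_real (d j) = complex_of_real (e i) * W $$ (i, j)"
    unfolding cancel[OF mat_diag_dim mat_diag_dim] intertwine .
  then have "\<forall>i<n. \<forall>j<n. W $$ (i, j) = 0 \<or> d j = e i"
    by (metis mult.commute mult_left_cancel of_real_eq_iff)
  then have "\<forall>i<n. \<forall>j<n. W $$ (i, j) * complex_of_real (f (d j)) = complex_of_real (f (e i)) * W $$ (i, j)"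
    by (metis mult.commute mult_zero_left)
  then show ?thesis
    unfolding cancel[OF mat_diag_dim mat_diag_dim] intertwine .
qed

text \<open>Uniqueness of the functional calculus makes the definite description well defined, so
  powers can be computed in any chosen diagonalization.\<close>

lemma mat_powr_spectral:
  assumes U: "unitary_mat n U" and d: "\<And>i. i < n \<Longrightarrow> 0 < d i"
    and A: "A = U * mat_diag n (\<lambda>i. complex_of_real (d i)) * mat_adjoint U"
  shows "mat_powr A p = U * mat_diag n (\<lambda>i. complex_of_real (d i powr p)) * mat_adjoint U"
proof -
  have n: "dim_row A = n" using unitary_matD(1)[OF U] by (simp add: A)
  show ?thesis
    unfolding mat_powr_def Let_def n
  proof (rule the_equality)
    show "\<exists>U' d'. unitary_mat n U' \<and> (\<forall>i<n. 0 < d' i) \<and>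
       A = U' * mat_diag n (\<lambda>i. complex_of_real (d' i)) * mat_adjoint U' \<and>
       U * mat_diag n (\<lambda>i. complex_of_real (d i powr p)) * mat_adjoint U
         = U' * mat_diag n (\<lambda>i. complex_of_real (d' i powr p)) * mat_adjoint U'"
      by (intro exI[of _ U] exI[of _ d] conjI U A refl allI impI d)
  next
    fix C assume "\<exists>U' d'. unitary_mat n U' \<and> (\<forall>i<n. 0 < d' i) \<and>
       A = U' * mat_diag n (\<lambda>i. complex_of_real (d' i)) * mat_adjoint U' \<and>
       C = U' * mat_diag n (\<lambda>i. complex_of_real (d' i powr p)) * mat_adjoint U'"
    then obtain V e where V: "unitary_mat n V"
      and AV: "A = V * mat_diag n (\<lambda>i. complex_of_real (e i)) * mat_adjoint V"
      and C: "C = V * mat_diag n (\<lambda>i. complex_of_real (e i powr p)) * mat_adjoint V"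
      by (elim exE conjE)
    show "C = U * mat_diag n (\<lambda>i. complex_of_real (d i powr p)) * mat_adjoint U"
      unfolding C
      by (rule spectral_calculus_unique[OF V U, where f = "\<lambda>x. x powr p"]) (use A AV in simp)
  qed
qed

text \<open>Similar matrices share their characteristic polynomial, and its two factorizations have
  the same roots. Equality of the sets of values suffices for a minimum over all pairs.\<close>

lemma eigenvalues_of_diagonalization:
  fixes A :: "complex mat" and lam :: "nat \<Rightarrow> complex"
  assumes U: "unitary_mat n U" and A: "A = U * mat_diag n d * mat_adjoint U"
    and cp: "char_poly A = (\<Prod>i\<in>{1..n}. [:- lam i, 1:])"
  shows "lam ` {1..n} = d ` {..<n}"
proof -
  note u = unitary_matD[OF U]
  have "similar_mat_wit A (mat_diag n d) U (mat_adjoint U)"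
    using u by (intro similar_mat_witI[of _ _ n]) (auto simp: A mult_carrier_mat[of _ n n _ n])
  then have "char_poly A = char_poly (mat_diag n d)"
    by (intro char_poly_similar) (auto simp: similar_mat_def)
  also have "\<dots> = (\<Prod>a\<leftarrow>diag_mat (mat_diag n d). [:- a, 1:])"
    by (rule char_poly_upper_triangular[OF mat_diag_dim]) (auto simp: mat_diag_def)
  also have "diag_mat (mat_diag n d) = map d [0..<n]"
    by (auto simp: diag_mat_def mat_diag_def)
  finally have "(\<Prod>a\<leftarrow>map d [0..<n]. [:- a, 1:]) = (\<Prod>i\<in>{1..n}. [:- lam i, 1:])"
    using cp by simp
  moreover have "(\<Prod>a\<leftarrow>map d [0..<n]. [:- a, 1:]) = (\<Prod>i\<in>{..<n}. [:- d i, 1:])"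
    using prod.distinct_set_conv_list[OF distinct_upt, of "\<lambda>i. [:- d i, 1:]" 0 n]
    by (simp add: o_def lessThan_atLeast0)
  ultimately have "poly (\<Prod>i\<in>{..<n}. [:- d i, 1:]) z = poly (\<Prod>i\<in>{1..n}. [:- lam i, 1:]) z" for z
    by simp
  then have "(\<Prod>i\<in>{..<n}. z - d i) = 0 \<longleftrightarrow> (\<Prod>i\<in>{1..n}. z - lam i) = 0" for z
    by (simp add: poly_prod)
  then have "(\<exists>i\<in>{..<n}. z = d i) \<longleftrightarrow> (\<exists>i\<in>{1..n}. z = lam i)" for z
    by (simp only: prod_zero_iff[OF finite_lessThan] prod_zero_iff[OF finite_atLeastAtMost] right_minus_eq)
  then show ?thesis by (auto simp: set_eq_iff image_iff)
qed

section \<open>The Frobenius norm in spectral coordinates\<close>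

lemma frobenius_norm_sq:
  "(frobenius_norm A)\<^sup>2 = (\<Sum>i<dim_row A. \<Sum>j<dim_col A. (cmod (A $$ (i, j)))\<^sup>2)"
  unfolding frobenius_norm_def by (intro real_sqrt_pow2 sum_nonneg) auto

lemma frobenius_norm_adjoint: "(frobenius_norm (mat_adjoint A))\<^sup>2 = (frobenius_norm A)\<^sup>2"
  unfolding frobenius_norm_sq by (subst sum.swap) simp

text \<open>The trace formula: it makes the norm depend on \<open>A\<close> only through
  \<open>mat_adjoint A * A\<close>, where a unitary left factor cancels.\<close>

lemma frobenius_norm_sq_adjoint_mult:
  assumes "A \<in> carrier_mat m n"
  shows "complex_of_real ((frobenius_norm A)\<^sup>2) = (\<Sum>j<n. (mat_adjoint A * A) $$ (j, j))"
proof -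
  have "(mat_adjoint A * A) $$ (j, j) = (\<Sum>i<m. complex_of_real ((cmod (A $$ (i, j)))\<^sup>2))" if "j < n" for j
    using assms that by (auto simp: scalar_prod_def lessThan_atLeast0 complex_norm_square mult.commute
        simp del: of_real_power intro!: sum.cong)
  then show ?thesis
    using assms unfolding frobenius_norm_sq by (subst sum.swap) simp
qed

lemma frobenius_norm_unitary_left:
  assumes U: "unitary_mat n U" and Y: "Y \<in> carrier_mat n m"
  shows "(frobenius_norm (U * Y))\<^sup>2 = (frobenius_norm Y)\<^sup>2"
proof -
  note u = unitary_matD[OF U]
  have "mat_adjoint (U * Y) * (U * Y) = mat_adjoint Y * (mat_adjoint U * (U * Y))"
    unfolding mat_adjoint_mult[OF u(1) Y]
    by (rule assoc_mult_mat[OF mat_adjoint_carrier[OF Y] u(2) mult_carrier_mat[OF u(1) Y]])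
  also have "mat_adjoint U * (U * Y) = Y"
    unfolding assoc_mult_mat[OF u(2) u(1) Y, symmetric] u(3) using Y by simp
  finally have "mat_adjoint (U * Y) * (U * Y) = mat_adjoint Y * Y" .
  then have "complex_of_real ((frobenius_norm (U * Y))\<^sup>2) = complex_of_real ((frobenius_norm Y)\<^sup>2)"
    unfolding frobenius_norm_sq_adjoint_mult[OF Y] frobenius_norm_sq_adjoint_mult[OF mult_carrier_mat[OF u(1) Y]]
    by simp
  then show ?thesis by (simp only: of_real_eq_iff)
qed

text \<open>The right factor is moved to the left by taking adjoints, which preserves the
  norm.\<close>

lemma frobenius_norm_unitary:
  assumes U: "unitary_mat n U" and V: "unitary_mat n V" and Y: "Y \<in> carrier_mat n n"
  shows "(frobenius_norm (U * Y * mat_adjoint V))\<^sup>2 = (frobenius_norm Y)\<^sup>2"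
proof -
  note u = unitary_matD[OF U] and v = unitary_matD[OF V]
  have "mat_adjoint (U * Y * mat_adjoint V) = V * mat_adjoint (U * Y)"
    using mat_adjoint_mult[OF mult_carrier_mat[OF u(1) Y] v(2)] by simp
  then have "(frobenius_norm (U * Y * mat_adjoint V))\<^sup>2 = (frobenius_norm (V * mat_adjoint (U * Y)))\<^sup>2"
    by (metis frobenius_norm_adjoint)
  also have "\<dots> = (frobenius_norm (U * Y))\<^sup>2"
    using frobenius_norm_unitary_left[OF V mat_adjoint_carrier[OF mult_carrier_mat[OF u(1) Y]]]
    by (simp add: frobenius_norm_adjoint)
  finally show ?thesis using frobenius_norm_unitary_left[OF U Y] by simp
qed

section \<open>Schur multipliers in a pair of orthonormal bases\<close>

text \<open>The Schur multiplier with symbol \<open>k\<close> relative to the bases \<open>U\<close>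
  and \<open>V\<close>, a finite double operator integral. Being linear in \<open>k\<close>, it
  turns the matrix expressions of the theorem into scalar expressions in the symbol.\<close>

definition double_spectral_mat ::
  "nat \<Rightarrow> complex mat \<Rightarrow> complex mat \<Rightarrow> complex mat \<Rightarrow> (nat \<Rightarrow> nat \<Rightarrow> real) \<Rightarrow> complex mat" where
  "double_spectral_mat n U V X k =
    U * mat n n (\<lambda>(i, j). complex_of_real (k i j) * (mat_adjoint U * X * V) $$ (i, j)) * mat_adjoint V"

context
  fixes n :: nat and U V :: "complex mat"
  assumes U: "unitary_mat n U" and V: "unitary_mat n V"
begin

lemma double_spectral_mat_add:
  "double_spectral_mat n U V X k + double_spectral_mat n U V X l
    = double_spectral_mat n U V X (\<lambda>i j. k i j + l i j)"
proof -
  note u = unitary_matD[OF U] and v = unitary_matD[OF V]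
  have "U * M * mat_adjoint V + U * N * mat_adjoint V = U * (M + N) * mat_adjoint V"
    if "M \<in> carrier_mat n n" "N \<in> carrier_mat n n" for M N
    using that u(1) v(2)
    by (simp add: mult_add_distrib_mat[of _ n n _ n] add_mult_distrib_mat[of _ n n _ _ n] mult_carrier_mat[of _ n n _ n])
  then show ?thesis
    unfolding double_spectral_mat_def
    by (simp, intro arg_cong2[of _ _ _ _ "(*)"] eq_matI) (auto simp: distrib_right)
qed

lemma double_spectral_mat_minus:
  "double_spectral_mat n U V X k - double_spectral_mat n U V X l
    = double_spectral_mat n U V X (\<lambda>i j. k i j - l i j)"
proof -
  note u = unitary_matD[OF U] and v = unitary_matD[OF V]
  have "U * M * mat_adjoint V - U * N * mat_adjoint V = U * (M - N) * mat_adjoint V"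
    if "M \<in> carrier_mat n n" "N \<in> carrier_mat n n" for M N
    using that u(1) v(2)
    by (simp add: mult_minus_distrib_mat[of _ n n _ n] minus_mult_distrib_mat[of _ n n _ _ n] mult_carrier_mat[of _ n n _ n])
  then show ?thesis
    unfolding double_spectral_mat_def
    by (simp, intro arg_cong2[of _ _ _ _ "(*)"] eq_matI) (auto simp: left_diff_distrib)
qed

lemma double_spectral_mat_smult:
  "complex_of_real c \<cdot>\<^sub>m double_spectral_mat n U V X k
    = double_spectral_mat n U V X (\<lambda>i j. c * k i j)"
proof -
  note u = unitary_matD[OF U] and v = unitary_matD[OF V]
  have "complex_of_real c \<cdot>\<^sub>m (U * M * mat_adjoint V) = U * (complex_of_real c \<cdot>\<^sub>m M) * mat_adjoint V"
    if "M \<in> carrier_mat n n" for M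
    using that u(1) v(2)
    by (simp add: mult_smult_distrib[of _ n n _ n] mult_smult_assoc_mat[of _ n n _ n] mult_carrier_mat[of _ n n _ n])
  then show ?thesis
    unfolding double_spectral_mat_def
    by (simp, intro arg_cong2[of _ _ _ _ "(*)"] eq_matI) (auto simp: mult.assoc)
qed

text \<open>Reassociation brings \<open>mat_adjoint U * X * V\<close> between the two diagonal
  matrices; the left one scales its rows and the right one its columns.\<close>

lemma double_spectral_mat_sandwich:
  fixes f g :: "nat \<Rightarrow> real"
  assumes X: "X \<in> carrier_mat n n"
  shows "(U * mat_diag n (\<lambda>i. complex_of_real (f i)) * mat_adjoint U) * X
      * (V * mat_diag n (\<lambda>j. complex_of_real (g j)) * mat_adjoint V)
    = double_spectral_mat n U V X (\<lambda>i j. f i * g j)" (is "(U * ?F * _) * X * (V * ?G * _) = _")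
proof -
  note u = unitary_matD[OF U] and v = unitary_matD[OF V]
  define Y where "Y = mat_adjoint U * X * V"
  have Y: "Y \<in> carrier_mat n n" using u v X by (simp add: Y_def mult_carrier_mat[of _ n n _ n])
  have "(U * ?F * mat_adjoint U) * X * (V * ?G * mat_adjoint V) = U * (?F * Y * ?G) * mat_adjoint V"
    using u(1,2) v(1,2) X unfolding Y_def
    by (simp add: assoc_mult_mat[of _ n n _ n _ n] mult_carrier_mat[of _ n n _ n])
  also have "?F * Y * ?G = mat n n (\<lambda>(i, j). complex_of_real (f i * g j) * Y $$ (i, j))"
    unfolding mat_diag_mult_left[OF Y] by (subst mat_diag_mult_right) (auto intro!: eq_matI)
  finally show ?thesis unfolding double_spectral_mat_def Y_def .
qed

lemma frobenius_norm_double_spectral_mat: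
  "(frobenius_norm (double_spectral_mat n U V X k))\<^sup>2
    = (\<Sum>i<n. \<Sum>j<n. (k i j)\<^sup>2 * (cmod ((mat_adjoint U * X * V) $$ (i, j)))\<^sup>2)"
proof -
  have "(frobenius_norm (double_spectral_mat n U V X k))\<^sup>2 = (frobenius_norm
      (mat n n (\<lambda>(i, j). complex_of_real (k i j) * (mat_adjoint U * X * V) $$ (i, j))))\<^sup>2"
    unfolding double_spectral_mat_def by (rule frobenius_norm_unitary[OF U V]) simp
  also have "\<dots> = (\<Sum>i<n. \<Sum>j<n. (k i j)\<^sup>2 * (cmod ((mat_adjoint U * X * V) $$ (i, j)))\<^sup>2)"
    unfolding frobenius_norm_sq by (simp add: norm_mult power_mult_distrib)
  finally show ?thesis .
qed

lemma frobenius_norm_double_spectral_mat_mono: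
  assumes "\<And>i j. i < n \<Longrightarrow> j < n \<Longrightarrow>
      (k1 i j)\<^sup>2 - c2 * (k2 i j)\<^sup>2 \<le> c3 * (k3 i j)\<^sup>2 - c4 * (k4 i j)\<^sup>2"
  shows "(frobenius_norm (double_spectral_mat n U V X k1))\<^sup>2
      - c2 * (frobenius_norm (double_spectral_mat n U V X k2))\<^sup>2
    \<le> c3 * (frobenius_norm (double_spectral_mat n U V X k3))\<^sup>2
      - c4 * (frobenius_norm (double_spectral_mat n U V X k4))\<^sup>2"
proof -
  let ?y = "\<lambda>i j. (cmod ((mat_adjoint U * X * V) $$ (i, j)))\<^sup>2"
  have "(\<Sum>i<n. \<Sum>j<n. ((k1 i j)\<^sup>2 - c2 * (k2 i j)\<^sup>2) * ?y i j)
    \<le> (\<Sum>i<n. \<Sum>j<n. (c3 * (k3 i j)\<^sup>2 - c4 * (k4 i j)\<^sup>2) * ?y i j)"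
    using assms by (intro sum_mono mult_right_mono) auto
  then show ?thesis
    unfolding frobenius_norm_double_spectral_mat
    by (simp add: left_diff_distrib sum_subtractf sum_distrib_left mult.assoc)
qed

end

section \<open>From scalar bounds to the matrix inequality\<close>

theorem theorem4p2:
  fixes A B X :: "complex mat" and n :: nat
    and lam nu :: "nat \<Rightarrow> real"
    and v r r1 rh1 Kmin :: real
  assumes "0 < n"
    and "positive_definite n A" and "positive_definite n B" and "X \<in> carrier_mat n n"
    and "char_poly A = (\<Prod>i\<in>{1..n}. [:- complex_of_real (lam i), 1:])"
    and "char_poly B = (\<Prod>j\<in>{1..n}. [:- complex_of_real (nu j), 1:])"
    and "Kmin = Min {kantorovich ((lam i / nu j) powr (1/2)) | i j. i \<in> {1..n} \<and> j \<in> {1..n}}"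
    and "0 < v" and "v < 1"
    and "r = min v (1 - v)"
    and "r1 = min (2 * r) (1 - 2 * r)"
    and "rh1 = min (2 * r1) (1 - 2 * r1)"
  shows "(v \<le> 1/2 \<longrightarrow>
      (frobenius_norm (complex_of_real (1 - v) \<cdot>\<^sub>m (A * X) + complex_of_real v \<cdot>\<^sub>m (X * B)))\<^sup>2
        - (1 - v)\<^sup>2 * (frobenius_norm (A * X - X * B))\<^sup>2
      \<le> Kmin powr (- rh1) * (frobenius_norm (mat_powr A (1 - v) * X * mat_powr B v))\<^sup>2
        - r1 * (frobenius_norm (mat_powr A (1/2) * X * mat_powr B (1/2) - X * B))\<^sup>2)
    \<and> (1/2 < v \<longrightarrow>
      (frobenius_norm (complex_of_real (1 - v) \<cdot>\<^sub>m (A * X) + complex_of_real v \<cdot>\<^sub>m (X * B)))\<^sup>2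
        - v\<^sup>2 * (frobenius_norm (A * X - X * B))\<^sup>2
      \<le> Kmin powr (- rh1) * (frobenius_norm (mat_powr A (1 - v) * X * mat_powr B v))\<^sup>2
        - r1 * (frobenius_norm (mat_powr A (1/2) * X * mat_powr B (1/2) - A * X))\<^sup>2)"
proof -
  note n = assms(1) and X = assms(4) and v = assms(8,9)
  obtain U d where U: "unitary_mat n U" and "\<forall>i<n. 0 < d i"
    and A: "A = U * mat_diag n (\<lambda>i. complex_of_real (d i)) * mat_adjoint U"
    using positive_definite_spectral[OF assms(2)] .
  obtain V e where V: "unitary_mat n V" and "\<forall>i<n. 0 < e i"
    and B: "B = V * mat_diag n (\<lambda>i. complex_of_real (e i)) * mat_adjoint V"
    using positive_definite_spectral[OF assms(3)] .
  then have d: "\<And>i. i < n \<Longrightarrow> 0 < d i" and e: "\<And>i. i < n \<Longrightarrow> 0 < e i"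
    using \<open>\<forall>i<n. 0 < d i\<close> by auto
  have "complex_of_real ` lam ` {1..n} = complex_of_real ` d ` {..<n}"
    using eigenvalues_of_diagonalization[OF U A assms(5)] by (simp add: image_image)
  then have lam: "lam ` {1..n} = d ` {..<n}"
    by (simp add: inj_image_eq_iff inj_on_def)
  have "complex_of_real ` nu ` {1..n} = complex_of_real ` e ` {..<n}"
    using eigenvalues_of_diagonalization[OF V B assms(6)] by (simp add: image_image)
  then have nu: "nu ` {1..n} = e ` {..<n}"
    by (simp add: inj_image_eq_iff inj_on_def)
  let ?K = "\<lambda>x y. kantorovich ((x / y) powr (1/2))"
  \<comment> \<open>The minimum depends on the eigenvalues only through their sets of values, so it
    can be taken over \<open>d\<close> and \<open>e\<close>, which are indexed from 0 instead of
    1.\<close>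
  have "{?K (lam i) (nu j) | i j. i \<in> S \<and> j \<in> S}
      = (\<lambda>(x, y). ?K x y) ` (lam ` S \<times> nu ` S)" for S :: "nat set"
    by (auto simp: image_iff)
  from this[of "{1..n}"] have Kmin: "Kmin = Min ((\<lambda>(x, y). ?K x y) ` (d ` {..<n} \<times> e ` {..<n}))"
    unfolding assms(7) lam nu by (rule arg_cong)
  have Kle: "Kmin \<le> ?K (d i) (e j)" if "i < n" "j < n" for i j
    unfolding Kmin using that by (intro Min_le) auto
  \<comment> \<open>As \<open>n\<close> is positive the minimum is attained, and it inherits
    positivity from the Kantorovich constant.\<close>
  have "Kmin \<in> (\<lambda>(x, y). ?K x y) ` (d ` {..<n} \<times> e ` {..<n})"
    unfolding Kmin using n by (intro Min_in) auto
  then obtain i j where "i < n" "j < n" "Kmin = ?K (d i) (e j)"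
    by auto
  then have Kpos: "0 < Kmin"
    using d[of i] e[of j] kantorovich_pos[of "(d i / e j) powr (1/2)"] by simp
  let ?T = "double_spectral_mat n U V X"
  have Apow: "mat_powr A p = U * mat_diag n (\<lambda>i. complex_of_real (d i powr p)) * mat_adjoint U" for p
    using mat_powr_spectral[OF U d A] .
  have Bpow: "mat_powr B p = V * mat_diag n (\<lambda>i. complex_of_real (e i powr p)) * mat_adjoint V" for p
    using mat_powr_spectral[OF V e B] .
  have pow: "mat_powr A p * X * mat_powr B q = ?T (\<lambda>i j. d i powr p * e j powr q)" for p q
    unfolding Apow Bpow by (rule double_spectral_mat_sandwich[OF U V X])
  \<comment> \<open>The constant function 1 yields the identity matrix, so \<open>A * X\<close> and
    \<open>X * B\<close> are sandwiches with one trivial factor.\<close>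
  have id: "W * mat_diag n (\<lambda>i. complex_of_real 1) * mat_adjoint W = 1\<^sub>m n" if "unitary_mat n W" for W
    using unitary_matD[OF that] by simp
  have Ac: "A \<in> carrier_mat n n" and Bc: "B \<in> carrier_mat n n"
    using assms(2,3) by (auto simp: positive_definite_def)
  have AX: "A * X = ?T (\<lambda>i j. d i)"
    using double_spectral_mat_sandwich[OF U V X, of d "\<lambda>_. 1"]
      right_mult_one_mat[OF mult_carrier_mat[OF Ac X]] unfolding id[OF V] A[symmetric] by simp
  have XB: "X * B = ?T (\<lambda>i j. e j)"
    using double_spectral_mat_sandwich[OF U V X, of "\<lambda>_. 1" e]
      left_mult_one_mat[OF X] unfolding id[OF U] B[symmetric] by simp
  note as_double = pow AX XB double_spectral_mat_smult[OF U V] double_spectral_mat_add[OF U V]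
    double_spectral_mat_minus[OF U V]
  show ?thesis
  proof (intro conjI impI)
    assume v2: "v \<le> 1 / 2"
    then have r: "r1 = min (2 * v) (1 - 2 * v)" using assms(10,11) by simp
    show "(frobenius_norm (complex_of_real (1 - v) \<cdot>\<^sub>m (A * X) + complex_of_real v \<cdot>\<^sub>m (X * B)))\<^sup>2
        - (1 - v)\<^sup>2 * (frobenius_norm (A * X - X * B))\<^sup>2
      \<le> Kmin powr (- rh1) * (frobenius_norm (mat_powr A (1 - v) * X * mat_powr B v))\<^sup>2
        - r1 * (frobenius_norm (mat_powr A (1/2) * X * mat_powr B (1/2) - X * B))\<^sup>2"
      \<comment> \<open>Every norm is now that of \<open>?T\<close> with an explicit symbol, and the
        entrywise comparison is the scalar bound at \<open>a = d i\<close>, \<open>b = e j\<close>,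
        \<open>k = Kmin\<close>.\<close>
      unfolding as_double assms(12) r
      by (intro frobenius_norm_double_spectral_mat_mono[OF U V] two_variable_bound d e Kpos Kle)
        (use v v2 in auto)
  next
    assume v2: "1 / 2 < v"
    then have r: "r1 = min (2 * (1 - v)) (1 - 2 * (1 - v))" using assms(10,11) by simp
    show "(frobenius_norm (complex_of_real (1 - v) \<cdot>\<^sub>m (A * X) + complex_of_real v \<cdot>\<^sub>m (X * B)))\<^sup>2
        - v\<^sup>2 * (frobenius_norm (A * X - X * B))\<^sup>2
      \<le> Kmin powr (- rh1) * (frobenius_norm (mat_powr A (1 - v) * X * mat_powr B v))\<^sup>2
        - r1 * (frobenius_norm (mat_powr A (1/2) * X * mat_powr B (1/2) - A * X))\<^sup>2"
      unfolding as_double assms(12) r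
      by (intro frobenius_norm_double_spectral_mat_mono[OF U V] two_variable_bound_swap d e Kpos Kle)
        (use v v2 in auto)
  qed
qed

end
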